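(* Let $\bar f,d\in\mathbb{R}$ with $0\le d<\bar f$, and let $$\mathcal{S}=\Big\{(x,f)\in\{0,1\}^n\times\mathbb{R}^{n+1}:\ f_0=0,\ \sum_{j=0}^n f_j=d,\ \ -\bar f x_j\le f_j\le \bar f x_j,\ j\in\{1,\dots,n\}\Big\}.$$ Let $X$ be the set of all $(x,f)\in[0,1]^n\times\mathbb{R}^{n+1}$ such that $f_0=0$, $\sum_{j=1}^n f_j=d$, $-\bar f x_j\le f_j\le\bar f x_j$ for $j\in\{1,\dots,n\}$, and $$\sum_{j\in J_1}(\bar f-d)(\bar f x_j+f_j)+\sum_{j\in J_2}(\bar f-d)\,d\,x_j+\sum_{j\in J_3}d\,(\bar f x_j-f_j)\ \ge\ (\bar f-d)\,d$$ for every partition $(J_1,J_2,J_3)$ of $\{1,\dots,n\}$. Then $\operatorname{conv}(\mathcal{S})=X$.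
   Context: Coordinates: $x=(x_1,\dots,x_n)$ and $f=(f_0,f_1,\dots,f_n)$. A partition $(J_1,J_2,J_3)$ of $\{1,\dots,n\}$ is an ordered triple of pairwise disjoint, possibly empty, subsets whose union is $\{1,\dots,n\}$. *)

theory Defs
  imports "HOL-Analysis.Analysis"
begin

text \<open>
  The finite type \<open>'n\<close> plays the role of the index set \<open>{1, \<dots>, n}\<close>, and \<open>'n option\<close> that of
  \<open>{0, 1, \<dots>, n}\<close>: the coordinate \<open>f\<^sub>0\<close> is \<open>f $ None\<close> and \<open>f\<^sub>j\<close> is \<open>f $ Some j\<close>.
\<close>

definition ordered_partition3 :: "'n set \<Rightarrow> 'n set \<Rightarrow> 'n set \<Rightarrow> bool" where
  "ordered_partition3 J1 J2 J3 \<longleftrightarrow>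
     J1 \<inter> J2 = {} \<and> J1 \<inter> J3 = {} \<and> J2 \<inter> J3 = {} \<and> J1 \<union> J2 \<union> J3 = UNIV"

definition flow_set :: "real \<Rightarrow> real \<Rightarrow> ((real ^ 'n::finite) \<times> (real ^ 'n option)) set" where
  "flow_set fbar d =
     {(x, f). (\<forall>j. x $ j \<in> {0, 1}) \<and> f $ None = 0 \<and> (\<Sum>j\<in>UNIV. f $ j) = d \<and>
        (\<forall>j. - fbar * x $ j \<le> f $ Some j \<and> f $ Some j \<le> fbar * x $ j)}"

definition flow_polytope :: "real \<Rightarrow> real \<Rightarrow> ((real ^ 'n::finite) \<times> (real ^ 'n option)) set" where
  "flow_polytope fbar d =
     {(x, f). (\<forall>j. x $ j \<in> {0..1}) \<and> f $ None = 0 \<and> (\<Sum>j\<in>UNIV. f $ Some j) = d \<and>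
        (\<forall>j. - fbar * x $ j \<le> f $ Some j \<and> f $ Some j \<le> fbar * x $ j) \<and>
        (\<forall>J1 J2 J3. ordered_partition3 J1 J2 J3 \<longrightarrow>
           (\<Sum>j\<in>J1. (fbar - d) * (fbar * x $ j + f $ Some j)) +
           (\<Sum>j\<in>J2. (fbar - d) * d * x $ j) +
           (\<Sum>j\<in>J3. d * (fbar * x $ j - f $ Some j)) \<ge> (fbar - d) * d)}"

end

theory Submission
  imports Defs
begin

text \<open>
  Write \<open>F\<close> for \<open>fbar\<close>. For a fixed point, the partition that makes its inequality tightest picks
  the smallest of three terms at each index, so the family of partition inequalities is one
  inequality \<open>\<Sum>\<^sub>j cover F d x\<^sub>j f\<^sub>j \<ge> (F - d) * d\<close> with a concave, positively homogeneous, piecewise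
  linear function \<open>cover\<close>. Hence the polytope is compact and convex and, by the theorem of
  Krein, Milman and Minkowski, it suffices that its extreme points have a binary \<open>x\<close>.

  Suppose first that \<open>d > 0\<close> and that the cover inequality is tight. The cone \<open>\<bar>f\<bar> \<le> F * x\<close> is cut by
  the four rays through \<open>(1, \<tau>)\<close>, \<open>\<tau> \<in> {- F, d - F, d, F}\<close>, into three chambers on which \<open>cover\<close> is
  linear. Every \<open>(x\<^sub>j, f\<^sub>j)\<close> is a combination, with weights \<open>p\<^sub>j, q\<^sub>j \<ge> 0\<close> of sum \<open>x\<^sub>j\<close>, of two
  neighbouring ray points. In the coordinates \<open>(\<alpha>, \<beta>)\<close> with \<open>\<alpha> = cover / ((F - d) * d)\<close> and
  \<open>f = F * \<beta> + d * \<alpha>\<close> the four ray points become \<open>(0, -1), (1, -1), (1, 0), (0, 1)\<close>, and the two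
  coupling constraints say that the total of all \<open>(\<alpha>, \<beta>)\<close> is the integral vector \<open>(1, 0)\<close>. These four
  vectors, and the differences of neighbouring ones, are roots of the root system of type \<open>A\<^sub>2\<close>. Two
  roots that are not parallel form a basis of the lattice \<open>\<int>\<^sup>2\<close>. A fractional weight can move along
  a root, and the fractional weights contribute an integral vector to the total; unimodularity then
  excludes that the available roots are linearly independent (\<open>roots_dependency\<close>). A dependency is
  a line segment through the point inside the polytope, so an extreme point has no fractional
  weight.

  If \<open>d = 0\<close> or the cover inequality is strict, it puts no restriction on small perturbations and
  only \<open>\<Sum>\<^sub>j f\<^sub>j = d\<close> couples the indices. A point with a fractional \<open>x\<^sub>j\<close> can be extreme only if
  every \<open>\<bar>f\<^sub>i\<bar> = F * x\<^sub>i\<close> and all other \<open>x\<^sub>i\<close> are binary. Then every cover term vanishes, so \<open>d = 0\<close>,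
  and \<open>\<Sum>\<^sub>j f\<^sub>j = 0\<close> makes \<open>x\<^sub>j\<close> integral.
\<close>

section \<open>The partition inequalities as one concave inequality\<close>

definition cover :: "real \<Rightarrow> real \<Rightarrow> real \<Rightarrow> real \<Rightarrow> real" where
  "cover F d x f = min ((F - d) * (F * x + f)) (min ((F - d) * d * x) (d * (F * x - f)))"

text \<open>
  The partition that sends each index to its smallest term attains the sum of the minima, and every
  other partition gives at least as much.
\<close>

lemma partition_inequalities_iff_cover:
  fixes x f :: "'n::finite \<Rightarrow> real"
  shows "(\<forall>J1 J2 J3. ordered_partition3 J1 J2 J3 \<longrightarrow>
           (\<Sum>j\<in>J1. (F - d) * (F * x j + f j)) + (\<Sum>j\<in>J2. (F - d) * d * x j) +
           (\<Sum>j\<in>J3. d * (F * x j - f j)) \<ge> m) \<longleftrightarrow> m \<le> (\<Sum>j\<in>UNIV. cover F d (x j) (f j))"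
    (is "(\<forall>J1 J2 J3. _ \<longrightarrow> ?T J1 J2 J3 \<ge> m) \<longleftrightarrow> _")
proof
  have split: "(\<Sum>j\<in>J1. h j) + (\<Sum>j\<in>J2. h j) + (\<Sum>j\<in>J3. h j) = (\<Sum>j\<in>UNIV. h j)"
    if "ordered_partition3 J1 J2 J3" for J1 J2 J3 :: "'n set" and h :: "'n \<Rightarrow> real"
  proof -
    have "(\<Sum>j\<in>UNIV. h j) = (\<Sum>j\<in>J1 \<union> J2 \<union> J3. h j)"
      using that by (simp add: ordered_partition3_def)
    also have "\<dots> = (\<Sum>j\<in>J1 \<union> J2. h j) + (\<Sum>j\<in>J3. h j)"
      using that by (intro sum.union_disjoint) (auto simp: ordered_partition3_def)
    also have "(\<Sum>j\<in>J1 \<union> J2. h j) = (\<Sum>j\<in>J1. h j) + (\<Sum>j\<in>J2. h j)"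
      using that by (intro sum.union_disjoint) (auto simp: ordered_partition3_def)
    finally show ?thesis by simp
  qed
  {
    assume all: "\<forall>J1 J2 J3. ordered_partition3 J1 J2 J3 \<longrightarrow> ?T J1 J2 J3 \<ge> m"
    define c where "c j = cover F d (x j) (f j)" for j
    define J1 where "J1 = {j. c j = (F - d) * (F * x j + f j)}"
    define J2 where "J2 = {j. c j = (F - d) * d * x j} - J1"
    define J3 where "J3 = - J1 - J2"
    have p: "ordered_partition3 J1 J2 J3"
      by (auto simp: ordered_partition3_def J2_def J3_def)
    have 3: "c j = d * (F * x j - f j)" if "j \<in> J3" for j
      using that unfolding J1_def J2_def J3_def c_def cover_def by (auto simp only: min_def split: if_splits)
    have "?T J1 J2 J3 = (\<Sum>j\<in>J1. c j) + (\<Sum>j\<in>J2. c j) + (\<Sum>j\<in>J3. c j)"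
      by (intro arg_cong2[where f = "(+)"] sum.cong) (auto simp: J1_def J2_def 3)
    then show "m \<le> (\<Sum>j\<in>UNIV. cover F d (x j) (f j))"
      using all p split[OF p, of c] by (fastforce simp: c_def)
  next
    assume m: "m \<le> (\<Sum>j\<in>UNIV. cover F d (x j) (f j))"
    show "\<forall>J1 J2 J3. ordered_partition3 J1 J2 J3 \<longrightarrow> ?T J1 J2 J3 \<ge> m"
    proof (intro allI impI)
      fix J1 J2 J3 :: "'n set"
      assume p: "ordered_partition3 J1 J2 J3"
      have "(\<Sum>j\<in>J1. cover F d (x j) (f j)) + (\<Sum>j\<in>J2. cover F d (x j) (f j))
          + (\<Sum>j\<in>J3. cover F d (x j) (f j)) \<le> ?T J1 J2 J3"
        by (intro add_mono sum_mono) (auto simp: cover_def)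
      then show "?T J1 J2 J3 \<ge> m" using split[OF p] m by simp
    qed
  }
qed

lemma cover_concave:
  assumes "0 \<le> u" "0 \<le> v"
  shows "u * cover F d x f + v * cover F d x' f' \<le> cover F d (u * x + v * x') (u * f + v * f')"
proof -
  have "u * cover F d x f + v * cover F d x' f' \<le> u * a + v * b"
    if "cover F d x f \<le> a" "cover F d x' f' \<le> b" for a b
    using that assms by (intro add_mono mult_left_mono)
  from this[of "(F - d) * (F * x + f)" "(F - d) * (F * x' + f')"]
    this[of "(F - d) * d * x" "(F - d) * d * x'"]
    this[of "d * (F * x - f)" "d * (F * x' - f')"]
  show ?thesis unfolding cover_def[of F d "u * x + v * x'"]
    by (simp add: cover_def algebra_simps)
qed

lemma flow_polytope_iff:
  "z \<in> flow_polytope F d \<longleftrightarrow> snd z $ None = 0 \<and> (\<Sum>j\<in>UNIV. snd z $ Some j) = d \<and>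
     (\<forall>j. 0 \<le> fst z $ j \<and> fst z $ j \<le> 1 \<and> \<bar>snd z $ Some j\<bar> \<le> F * fst z $ j) \<and>
     (F - d) * d \<le> (\<Sum>j\<in>UNIV. cover F d (fst z $ j) (snd z $ Some j))"
  unfolding flow_polytope_def case_prod_unfold mem_Collect_eq partition_inequalities_iff_cover
  by (auto simp: abs_le_iff minus_le_iff)

lemma convex_flow_polytope: "convex (flow_polytope F d)"
  unfolding convex_def
proof (intro ballI allI impI)
  fix z w :: "(real ^ 'n::finite) \<times> (real ^ 'n option)" and u v :: real
  assume z: "z \<in> flow_polytope F d" and w: "w \<in> flow_polytope F d"
    and uv: "0 \<le> u" "0 \<le> v" "u + v = 1"
  let ?c = "\<lambda>z j. cover F d (fst z $ j) (snd z $ Some j)"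
  have "(F - d) * d = u * ((F - d) * d) + v * ((F - d) * d)"
    using uv by (metis distrib_right mult_1)
  also have "\<dots> \<le> u * (\<Sum>j\<in>UNIV. ?c z j) + v * (\<Sum>j\<in>UNIV. ?c w j)"
    using z w uv by (intro add_mono mult_left_mono) (auto simp: flow_polytope_iff)
  also have "\<dots> \<le> (\<Sum>j\<in>UNIV. ?c (u *\<^sub>R z + v *\<^sub>R w) j)"
    using uv by (auto simp: sum_distrib_left sum.distrib[symmetric] intro!: sum_mono cover_concave)
  finally have cov: "(F - d) * d \<le> (\<Sum>j\<in>UNIV. ?c (u *\<^sub>R z + v *\<^sub>R w) j)" .
  have "u * (snd z $ Some j) + v * (snd w $ Some j) \<le> F * (u * fst z $ j + v * fst w $ j)" for j
    using mult_left_mono[of "snd z $ Some j" "F * fst z $ j" u]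
      mult_left_mono[of "snd w $ Some j" "F * fst w $ j" v] z w uv
    by (auto simp: flow_polytope_iff abs_le_iff algebra_simps)
  moreover have "- (u * (snd z $ Some j) + v * (snd w $ Some j)) \<le> F * (u * fst z $ j + v * fst w $ j)" for j
    using mult_left_mono[of "- snd z $ Some j" "F * fst z $ j" u]
      mult_left_mono[of "- snd w $ Some j" "F * fst w $ j" v] z w uv
    by (auto simp: flow_polytope_iff abs_le_iff algebra_simps)
  ultimately have "\<bar>u * (snd z $ Some j) + v * (snd w $ Some j)\<bar> \<le> F * (u * fst z $ j + v * fst w $ j)" for j
    by (simp add: abs_le_iff)
  moreover have "(\<Sum>j\<in>UNIV. u * (snd z $ Some j) + v * (snd w $ Some j)) = d"
    using z w uv by (simp add: flow_polytope_iff sum.distrib flip: sum_distrib_left distrib_right)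
  moreover have "u * fst z $ j + v * fst w $ j \<le> 1" for j
    using z w uv by (intro convex_bound_le) (auto simp: flow_polytope_iff)
  ultimately show "u *\<^sub>R z + v *\<^sub>R w \<in> flow_polytope F d"
    using cov z w uv by (simp add: flow_polytope_iff)
qed

lemma compact_flow_polytope:
  assumes "0 \<le> F"
  shows "compact (flow_polytope F d :: ((real ^ 'n::finite) \<times> (real ^ 'n option)) set)"
    (is "compact ?X")
proof -
  have "closed {z :: (real ^ 'n) \<times> (real ^ 'n option). snd z $ None = 0 \<and>
     (\<Sum>j\<in>UNIV. snd z $ Some j) = d \<and>
     (\<forall>j. 0 \<le> fst z $ j \<and> fst z $ j \<le> 1 \<and> \<bar>snd z $ Some j\<bar> \<le> F * fst z $ j) \<and>
     (F - d) * d \<le> (\<Sum>j\<in>UNIV. cover F d (fst z $ j) (snd z $ Some j))}"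
    unfolding cover_def
    by (intro closed_Collect_conj closed_Collect_all closed_Collect_eq closed_Collect_le continuous_intros)
  then have "closed ?X"
    by (rule back_subst[of closed]) (auto simp: flow_polytope_iff)
  moreover have "?X \<subseteq> cbox 0 (\<chi> j. 1) \<times> cbox (\<chi> k. - F) (\<chi> k. F)"
  proof
    fix z
    assume z: "z \<in> ?X"
    have "\<bar>snd z $ k\<bar> \<le> F" for k
    proof (cases k)
      case (Some j)
      have "\<bar>snd z $ Some j\<bar> \<le> F * fst z $ j" "fst z $ j \<le> 1"
        using z by (auto simp: flow_polytope_iff)
      then show ?thesis using Some mult_left_mono[of "fst z $ j" 1 F] assms by simp
    qed (use z assms in \<open>auto simp: flow_polytope_iff\<close>)
    then show "z \<in> cbox 0 (\<chi> j. 1) \<times> cbox (\<chi> k. - F) (\<chi> k. F)"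
      using z by (auto simp: mem_Times_iff mem_box_cart flow_polytope_iff abs_le_iff minus_le_iff)
  qed
  ultimately show ?thesis
    by (metis compact_Int_closed compact_Times compact_cbox inf.absorb2)
qed

text \<open>
  An index of \<open>J2\<close> with \<open>x\<^sub>j = 1\<close> alone contributes the right-hand side. Otherwise \<open>J2\<close> carries no flow,
  and the whole flow \<open>d\<close> is split as \<open>a + b\<close> between \<open>J1\<close> and \<open>J3\<close>, with \<open>k1\<close> and \<open>k3\<close> open indices.
  The inequality becomes \<open>a + (F - d) * k1 + d * k3 \<ge> d\<close>. For \<open>k1 \<ge> k3\<close> it follows from the capacity
  bound \<open>b \<le> F * k3\<close>, and for \<open>k3 \<ge> k1 + 1\<close> from \<open>a \<ge> - F * k1\<close>; integrality of \<open>k1\<close> and \<open>k3\<close> leaves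
  no gap between the two cases.
\<close>

lemma flow_set_subset_flow_polytope:
  assumes d: "0 \<le> d" "d < F"
  shows "flow_set F d \<subseteq> flow_polytope F d"
proof
  fix z :: "(real ^ 'n::finite) \<times> (real ^ 'n option)"
  assume z: "z \<in> flow_set F d"
  obtain x f where zxf: "z = (x, f)" by (cases z)
  have bin: "x $ j \<in> {0, 1}" and lo: "0 \<le> F * x $ j + f $ Some j"
    and hi: "0 \<le> F * x $ j - f $ Some j" for j
    using z by (auto simp: flow_set_def zxf minus_le_iff add.commute le_diff_eq diff_le_eq neg_le_iff_le dest: spec[of _ j])
  have x0: "0 \<le> x $ j" for j using bin[of j] by auto
  have f0: "f $ None = 0" using z by (simp add: flow_set_def zxf)
  have "(\<Sum>k\<in>UNIV. f $ k) = (\<Sum>j\<in>UNIV. f $ Some j)"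
    by (simp add: UNIV_option_conv f0 sum.reindex)
  then have sumf: "(\<Sum>j\<in>UNIV. f $ Some j) = d" using z by (simp add: flow_set_def zxf)
  have "(F - d) * d \<le> (\<Sum>j\<in>J1. (F - d) * (F * x $ j + f $ Some j)) +
      (\<Sum>j\<in>J2. (F - d) * d * x $ j) + (\<Sum>j\<in>J3. d * (F * x $ j - f $ Some j))"
    if p: "ordered_partition3 J1 J2 J3" for J1 J2 J3
  proof -
    define k1 k3 a b where "k1 = (\<Sum>j\<in>J1. x $ j)" and "k3 = (\<Sum>j\<in>J3. x $ j)"
      and "a = (\<Sum>j\<in>J1. f $ Some j)" and "b = (\<Sum>j\<in>J3. f $ Some j)"
    have T1: "(\<Sum>j\<in>J1. (F - d) * (F * x $ j + f $ Some j)) = (F - d) * (F * k1 + a)"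
      by (simp add: k1_def a_def sum.distrib flip: sum_distrib_left)
    have T3: "(\<Sum>j\<in>J3. d * (F * x $ j - f $ Some j)) = d * (F * k3 - b)"
      by (simp add: k3_def b_def sum_subtractf flip: sum_distrib_left)
    have a1: "0 \<le> F * k1 + a" "0 \<le> F * k1 - a"
      unfolding k1_def a_def sum_distrib_left sum.distrib[symmetric] sum_subtractf[symmetric]
      by (intro sum_nonneg; use lo hi in simp)+
    have b3: "0 \<le> F * k3 - b"
      unfolding k3_def b_def sum_distrib_left sum_subtractf[symmetric]
      by (intro sum_nonneg; use hi in simp)
    have T2: "0 \<le> (\<Sum>j\<in>J2. (F - d) * d * x $ j)"
      using d x0 by (intro sum_nonneg) simp
    show ?thesis
    proof (cases "\<exists>j\<in>J2. x $ j = 1")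
      case True
      then obtain j where j: "j \<in> J2" "x $ j = 1" by auto
      have "(F - d) * d * x $ j \<le> (\<Sum>j\<in>J2. (F - d) * d * x $ j)"
        using j d x0 by (intro member_le_sum) auto
      then show ?thesis unfolding T1 T3 using j a1 b3 d by (simp add: add_increasing add_increasing2)
    next
      case False
      then have "f $ Some j = 0" if "j \<in> J2" for j
        using that bin[of j] lo[of j] hi[of j] by auto
      then have ab: "a + b = d"
        unfolding sumf[symmetric] a_def b_def using p
        by (subst sum.union_disjoint[symmetric])
          (auto simp: ordered_partition3_def intro!: sum.mono_neutral_left)
      have "x $ j \<in> \<int>" for j using bin[of j] by auto
      then have "k1 \<in> \<int>" "k3 \<in> \<int>" unfolding k1_def k3_def by auto
      then obtain i1 i3 where i: "k1 = of_int i1" "k3 = of_int i3" by (auto elim!: Ints_cases)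
      have "0 \<le> a + (F - d) * k1 + d * k3 - d"
      proof (cases "i3 \<le> i1")
        case True
        then have "0 \<le> (F - d) * (k1 - k3)" using d i by simp
        then show ?thesis using b3 ab by (simp add: algebra_simps)
      next
        case False
        then have "0 \<le> d * (k3 - k1 - 1)" using d i by simp
        then show ?thesis using a1 by (simp add: algebra_simps)
      qed
      then have "0 \<le> F * (a + (F - d) * k1 + d * k3 - d)" using d by simp
      also have "\<dots> = (F - d) * (F * k1 + a) + d * (F * k3 - b) - (F - d) * d"
        unfolding ab[symmetric] by (simp add: algebra_simps)
      finally show ?thesis using T1 T2 T3 by simp
    qed
  qed
  then have "(F - d) * d \<le> (\<Sum>j\<in>UNIV. cover F d (x $ j) (f $ Some j))"
    by (intro partition_inequalities_iff_cover[THEN iffD1]) blast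
  moreover have "x $ j \<le> 1" "\<bar>f $ Some j\<bar> \<le> F * x $ j" for j
    using bin[of j] lo[of j] hi[of j] by auto
  ultimately show "z \<in> flow_polytope F d"
    using f0 sumf x0 by (simp add: flow_polytope_iff zxf)
qed

section \<open>Perturbing extreme points\<close>

lemma extreme_point_rigid:
  fixes z v :: "'a::real_vector"
  assumes "z extreme_point_of S" "\<forall>\<^sub>F s in nhds (0::real). z + s *\<^sub>R v \<in> S"
  shows "v = 0"
proof (rule ccontr)
  assume v: "v \<noteq> 0"
  obtain e where e: "e > 0" "\<And>s. dist s 0 < e \<Longrightarrow> z + s *\<^sub>R v \<in> S"
    using assms(2) unfolding eventually_nhds_metric by auto
  define a b where "a = z + (e/2) *\<^sub>R v" and "b = z + (- e/2) *\<^sub>R v"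
  have "a \<in> S" "b \<in> S"
    using e(1) e(2)[of "e/2"] e(2)[of "- e/2"] by (auto simp: a_def b_def)
  moreover have "a - b = e *\<^sub>R v" by (simp add: a_def b_def flip: scaleR_add_left)
  then have "a \<noteq> b" using v e(1) by auto
  moreover have "z = (1 - 1/2) *\<^sub>R a + (1/2) *\<^sub>R b"
    by (simp add: a_def b_def algebra_simps flip: scaleR_add_left)
  ultimately show False
    using assms(1) unfolding extreme_point_of_def in_segment
    by (metis half_gt_zero_iff one_less_numeral_iff semiring_norm(76) zero_less_one
        divide_less_eq_1_pos zero_less_numeral)
qed

definition flow_point :: "('n::finite \<Rightarrow> real) \<Rightarrow> ('n \<Rightarrow> real) \<Rightarrow> (real ^ 'n) \<times> (real ^ 'n option)" where
  "flow_point x f = (\<chi> j. x j, \<chi> k. case k of None \<Rightarrow> 0 | Some j \<Rightarrow> f j)"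

lemma flow_point_in_flow_polytope:
  "flow_point x f \<in> flow_polytope F d \<longleftrightarrow> (\<Sum>j\<in>UNIV. f j) = d \<and>
     (\<forall>j. 0 \<le> x j \<and> x j \<le> 1 \<and> \<bar>f j\<bar> \<le> F * x j) \<and>
     (F - d) * d \<le> (\<Sum>j\<in>UNIV. cover F d (x j) (f j))"
  by (simp add: flow_polytope_iff flow_point_def)

lemma flow_polytope_cases:
  assumes "z \<in> flow_polytope F d"
  obtains x f where "z = flow_point x f"
proof
  show "z = flow_point (\<lambda>j. fst z $ j) (\<lambda>j. snd z $ Some j)"
    using assms by (auto simp: flow_point_def flow_polytope_iff prod_eq_iff vec_eq_iff split: option.splits)
qed

lemma flow_point_add_scaleR:
  "flow_point x f + s *\<^sub>R flow_point u g = flow_point (\<lambda>j. x j + s * u j) (\<lambda>j. f j + s * g j)"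
  by (simp add: flow_point_def prod_eq_iff vec_eq_iff split: option.splits)

lemma flow_point_eq_0_iff: "flow_point u g = 0 \<longleftrightarrow> (\<forall>j. u j = 0 \<and> g j = 0)"
  by (auto simp: flow_point_def prod_eq_iff vec_eq_iff split: option.splits)

text \<open>
  The parameter \<open>s\<close> runs through a neighbourhood of \<open>0\<close> and so takes both signs: a nonzero direction
  \<open>(u, g)\<close> would put the extreme point inside a segment of the polytope.
\<close>

lemma extreme_flow_point_rigid:
  assumes "flow_point x f extreme_point_of flow_polytope F d"
    and "(\<Sum>j\<in>UNIV. g j) = 0"
    and "\<And>j. \<forall>\<^sub>F s in nhds 0. 0 \<le> x j + s * u j \<and> x j + s * u j \<le> 1 \<and> \<bar>f j + s * g j\<bar> \<le> F * (x j + s * u j)"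
    and "\<forall>\<^sub>F s in nhds 0. (F - d) * d \<le> (\<Sum>j\<in>UNIV. cover F d (x j + s * u j) (f j + s * g j))"
  shows "u j = 0 \<and> g j = 0"
proof -
  have sumf: "(\<Sum>j\<in>UNIV. f j) = d"
    using assms(1) by (simp add: extreme_point_of_def flow_point_in_flow_polytope)
  have "\<forall>\<^sub>F s in nhds 0. \<forall>j. 0 \<le> x j + s * u j \<and> x j + s * u j \<le> 1 \<and> \<bar>f j + s * g j\<bar> \<le> F * (x j + s * u j)"
    using assms(3) by (intro eventually_all_finite)
  with assms(4) have "\<forall>\<^sub>F s in nhds 0. flow_point x f + s *\<^sub>R flow_point u g \<in> flow_polytope F d"
    by eventually_elim
      (simp add: flow_point_add_scaleR flow_point_in_flow_polytope sum.distrib sumf assms(2) flip: sum_distrib_left)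
  then have "flow_point u g = 0" by (rule extreme_point_rigid[OF assms(1)])
  then show ?thesis by (simp add: flow_point_eq_0_iff)
qed

lemma eventually_affine_pos:
  assumes "0 < (y::real)" shows "\<forall>\<^sub>F s in nhds 0. 0 < y + s * r"
proof -
  have "((\<lambda>s. y + s * r) \<longlongrightarrow> y + 0 * r) (nhds 0)" by (intro tendsto_intros filterlim_ident)
  then show ?thesis by (rule order_tendstoD(1)) (use assms in auto)
qed

section \<open>Extreme points at which the cover inequality is inactive\<close>

lemma frac_not_Ints:
  assumes "0 < (c::real)" "c < 1" shows "c \<notin> \<int>" "- c \<notin> \<int>"
  using assms by (auto elim!: Ints_cases simp: minus_equation_iff[of c])

text \<open>
  An index is flexible if its flow can be changed in both directions, at unit speed, with \<open>x\<close>
  following along linearly. Two flexible indices can exchange flow, which is what an extreme point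
  forbids.
\<close>

definition flexible :: "real \<Rightarrow> real \<Rightarrow> real \<Rightarrow> bool" where
  "flexible F x f \<longleftrightarrow> (\<exists>u. \<forall>\<^sub>F s in nhds 0. 0 \<le> x + s * u \<and> x + s * u \<le> 1 \<and> \<bar>f + s\<bar> \<le> F * (x + s * u))"

text \<open>
  If \<open>\<bar>f\<bar> < F * x\<close>, the flow moves while \<open>x\<close> stays. If \<open>\<bar>f\<bar> = F * x\<close> with a fractional \<open>x\<close>, the pair
  \<open>(x, f)\<close> moves along its ray through the origin.
\<close>

lemma not_flexible:
  assumes "\<not> flexible F x f" "0 < F" "0 \<le> x" "x \<le> 1" "\<bar>f\<bar> \<le> F * x"
  shows "x \<in> {0, 1}" "\<bar>f\<bar> = F * x"
proof -
  show f: "\<bar>f\<bar> = F * x"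
  proof (rule ccontr)
    assume "\<bar>f\<bar> \<noteq> F * x"
    then have "0 < F * x - f" "0 < F * x + f" using assms by auto
    from eventually_affine_pos[OF this(1), of "-1"] eventually_affine_pos[OF this(2), of 1]
    have "\<forall>\<^sub>F s in nhds 0. 0 \<le> x + s * 0 \<and> x + s * 0 \<le> 1 \<and> \<bar>f + s\<bar> \<le> F * (x + s * 0)"
      by eventually_elim (use assms in \<open>auto simp: abs_le_iff\<close>)
    then show False using assms(1) unfolding flexible_def by blast
  qed
  show "x \<in> {0, 1}"
  proof (rule ccontr)
    assume "x \<notin> {0, 1}"
    then have x: "0 < x" "0 < 1 - x" using assms by auto
    define u where "u = (if f = F * x then 1 / F else - (1 / F))"
    have "\<forall>\<^sub>F s in nhds 0. 0 \<le> x + s * u \<and> x + s * u \<le> 1 \<and> \<bar>f + s\<bar> \<le> F * (x + s * u)"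
      using eventually_affine_pos[OF x(1), of u] eventually_affine_pos[OF x(2), of "- u"]
    proof eventually_elim
      case (elim s)
      have "\<bar>f + s\<bar> = \<bar>F * (x + s * u)\<bar>"
        using f assms(2,3) by (auto simp: u_def algebra_simps abs_if split: if_splits)
      also have "\<dots> = F * (x + s * u)" using elim assms(2) by simp
      finally show ?case using elim by auto
    qed
    then show False using assms(1) unfolding flexible_def by blast
  qed
qed

lemma cover_boundary:
  assumes "0 \<le> d" "d < F" "\<bar>f\<bar> = F * x" "0 \<le> x"
  shows "cover F d x f = 0"
proof -
  have "0 \<le> (F - d) * d * x" "0 \<le> F * x + f" "0 \<le> F * x - f" using assms by auto
  then have "0 \<le> (F - d) * d * x" "0 \<le> (F - d) * (F * x + f)" "0 \<le> d * (F * x - f)"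
    using assms by auto
  moreover have "F * x + f = 0 \<or> F * x - f = 0" using assms(3) by (auto simp: abs_if split: if_splits)
  then have "(F - d) * (F * x + f) = 0 \<or> d * (F * x - f) = 0" by auto
  ultimately show ?thesis unfolding cover_def by linarith
qed

text \<open>
  Here the cover inequality survives every small perturbation: by continuity if it is strict, and
  because \<open>cover F 0\<close> vanishes on the cone \<open>\<bar>f\<bar> \<le> F * x\<close> if \<open>d = 0\<close>. A fractional \<open>x\<^sub>j\<close> makes \<open>j\<close>
  flexible, so no other index is, and \<open>\<bar>f\<^sub>j\<bar> = F * x\<^sub>j\<close> since otherwise \<open>x\<^sub>j\<close> could move alone. So all cover
  terms vanish, which leaves \<open>d = 0\<close>, and then \<open>f\<^sub>j\<close> is a multiple of \<open>F\<close> like all other flows.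
\<close>

lemma extreme_point_binary_if_loose:
  fixes x f :: "'n::finite \<Rightarrow> real"
  assumes d: "0 \<le> d" "d < F" and ext: "flow_point x f extreme_point_of flow_polytope F d"
    and loose: "d = 0 \<or> (F - d) * d < (\<Sum>j\<in>UNIV. cover F d (x j) (f j))"
  shows "x j \<in> {0, 1}"
proof (rule ccontr)
  assume "x j \<notin> {0, 1}"
  have F: "0 < F" using d by simp
  have mem: "(\<Sum>j\<in>UNIV. f j) = d" "0 \<le> x i" "x i \<le> 1" "\<bar>f i\<bar> \<le> F * x i" for i
    using ext by (auto simp: extreme_point_of_def flow_point_in_flow_polytope)
  have j: "0 < x j" "0 < 1 - x j"
    using \<open>x j \<notin> {0, 1}\<close> mem(2,3)[of j] by (auto simp: less_le)
  have rigid: "u i = 0 \<and> g i = 0" if "(\<Sum>j\<in>UNIV. g j) = 0"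
    and box: "\<And>j. \<forall>\<^sub>F s in nhds 0. 0 \<le> x j + s * u j \<and> x j + s * u j \<le> 1 \<and> \<bar>f j + s * g j\<bar> \<le> F * (x j + s * u j)"
    for u g i
  proof -
    have "\<forall>\<^sub>F s in nhds 0. (F - d) * d \<le> (\<Sum>j\<in>UNIV. cover F d (x j + s * u j) (f j + s * g j))"
    proof (cases "d = 0")
      case True
      have "\<forall>\<^sub>F s in nhds 0. \<forall>j. 0 \<le> x j + s * u j \<and> x j + s * u j \<le> 1 \<and> \<bar>f j + s * g j\<bar> \<le> F * (x j + s * u j)"
        using box by (intro eventually_all_finite)
      then show ?thesis
      proof eventually_elim
        case (elim s)
        have "cover F d (x j + s * u j) (f j + s * g j) = 0" for j
        proof -
          have "0 \<le> F * (F * (x j + s * u j) + (f j + s * g j))"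
            using elim[rule_format, of j] F by (simp add: abs_le_iff)
          then show ?thesis using True by (simp add: cover_def min_def)
        qed
        then show ?case using True by simp
      qed
    next
      case False
      have "((\<lambda>s. \<Sum>j\<in>UNIV. cover F d (x j + s * u j) (f j + s * g j)) \<longlongrightarrow>
          (\<Sum>j\<in>UNIV. cover F d (x j + 0 * u j) (f j + 0 * g j))) (nhds 0)"
        unfolding cover_def by (intro tendsto_intros filterlim_ident)
      then have "\<forall>\<^sub>F s in nhds 0. (F - d) * d < (\<Sum>j\<in>UNIV. cover F d (x j + s * u j) (f j + s * g j))"
        by (rule order_tendstoD(1)) (use loose False in simp)
      then show ?thesis by (rule eventually_mono) simp
    qed
    then show ?thesis by (rule extreme_flow_point_rigid[OF ext that])
  qed
  have bd_j: "\<bar>f j\<bar> = F * x j"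
  proof (rule ccontr)
    assume "\<bar>f j\<bar> \<noteq> F * x j"
    then have 3: "0 < F * x j - f j" "0 < F * x j + f j" using mem(4)[of j] by auto
    define u where "u i = (if i = j then 1 else 0 :: real)" for i
    have ev: "\<forall>\<^sub>F s in nhds 0. 0 \<le> x j + s \<and> x j + s \<le> 1 \<and> \<bar>f j\<bar> \<le> F * (x j + s)"
      using eventually_affine_pos[OF j(1), of 1] eventually_affine_pos[OF j(2), of "-1"]
        eventually_affine_pos[OF 3(1), of F] eventually_affine_pos[OF 3(2), of F]
      by eventually_elim (auto simp: abs_le_iff algebra_simps)
    have "u j = 0 \<and> (0::real) = 0"
    proof (rule rigid[where g = "\<lambda>_. 0"])
      fix i
      show "\<forall>\<^sub>F s in nhds 0. 0 \<le> x i + s * u i \<and> x i + s * u i \<le> 1 \<and> \<bar>f i + s * 0\<bar> \<le> F * (x i + s * u i)"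
        using ev mem(2-4)[of i] by (cases "i = j") (auto simp: u_def)
    qed simp
    then show False by (simp add: u_def)
  qed
  have "flexible F (x j) (f j)"
    using not_flexible(1)[OF _ F mem(2-4)] \<open>x j \<notin> {0, 1}\<close> by blast
  then obtain uj where uj: "\<forall>\<^sub>F s in nhds 0. 0 \<le> x j + s * uj \<and> x j + s * uj \<le> 1 \<and> \<bar>f j + s\<bar> \<le> F * (x j + s * uj)"
    unfolding flexible_def by blast
  have others: "\<not> flexible F (x i) (f i)" if "i \<noteq> j" for i
  proof
    assume "flexible F (x i) (f i)"
    then obtain ui where ui: "\<forall>\<^sub>F s in nhds 0. 0 \<le> x i + s * ui \<and> x i + s * ui \<le> 1 \<and> \<bar>f i + s\<bar> \<le> F * (x i + s * ui)"
      unfolding flexible_def by blast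
    \<comment> \<open>The index \<open>i\<close> has to give up what \<open>j\<close> receives, so its motion is run backwards.\<close>
    have "filterlim uminus (nhds 0) (nhds (0::real))"
      using tendsto_minus[OF filterlim_ident, of "0::real"] by simp
    from eventually_compose_filterlim[OF ui this]
    have ui': "\<forall>\<^sub>F s in nhds 0. 0 \<le> x i + s * - ui \<and> x i + s * - ui \<le> 1 \<and> \<bar>f i + s * - 1\<bar> \<le> F * (x i + s * - ui)"
      by simp
    define g where "g k = (if k = j then 1 else if k = i then - 1 else 0 :: real)" for k
    define u where "u k = (if k = j then uj else if k = i then - ui else 0)" for k
    have "(\<Sum>k\<in>UNIV. g k) = (\<Sum>k\<in>{i, j}. g k)"
      by (rule sum.mono_neutral_right) (auto simp: g_def)
    also have "\<dots> = 0" using that by (simp add: g_def)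
    finally have "u j = 0 \<and> g j = 0"
    proof (rule rigid)
      fix k
      show "\<forall>\<^sub>F s in nhds 0. 0 \<le> x k + s * u k \<and> x k + s * u k \<le> 1 \<and> \<bar>f k + s * g k\<bar> \<le> F * (x k + s * u k)"
        using uj ui' mem(2-4)[of k] that by (cases "k = j"; cases "k = i") (auto simp: u_def g_def)
    qed
    then show False by (simp add: g_def)
  qed
  have bd: "\<bar>f i\<bar> = F * x i" for i
    using not_flexible(2)[OF others F mem(2-4)] bd_j by (cases "i = j") auto
  then have "(\<Sum>j\<in>UNIV. cover F d (x j) (f j)) = 0"
    using cover_boundary[OF d bd mem(2)] by simp
  moreover have "0 \<le> (F - d) * d" using d by simp
  ultimately have "d = 0" using loose by linarith
  then have "f j = - (\<Sum>i\<in>UNIV - {j}. f i)"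
    using mem(1) by (simp add: sum.remove[of UNIV j])
  then have "f j / F = - (\<Sum>i\<in>UNIV - {j}. f i / F)" by (simp add: sum_divide_distrib)
  also have "\<dots> \<in> \<int>"
  proof (intro Ints_minus Ints_sum)
    fix i assume "i \<in> UNIV - {j}"
    then have "x i \<in> {0, 1}" using not_flexible(1)[OF others F mem(2-4)] by blast
    then have "f i = 0 \<or> f i = F \<or> f i = - F" using bd[of i] F by auto
    then show "f i / F \<in> \<int>" using F by auto
  qed
  finally have "f j / F \<in> \<int>" .
  moreover have "f j = F * x j \<or> f j = - (F * x j)" using bd_j by linarith
  ultimately show False using frac_not_Ints[of "x j"] j F by auto
qed

section \<open>Unimodularity of the roots\<close>

text \<open>
  The six roots of the root system of type \<open>A\<^sub>2\<close>, in coordinates with respect to two roots at an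
  angle of 60 degrees.
\<close>

definition roots :: "(real \<times> real) set" where
  "roots = {(1, 0), (- 1, 0), (0, 1), (0, - 1), (1, - 1), (- 1, 1)}"

definition cross :: "real \<times> real \<Rightarrow> real \<times> real \<Rightarrow> real" where
  "cross v w = fst v * snd w - snd v * fst w"

lemma roots_cross:
  assumes "v \<in> roots" "w \<in> roots"
  shows "cross v w \<in> {- 1, 0, 1}" "cross v w = 0 \<Longrightarrow> w = v \<or> w = - v"
  using assms by (auto simp: roots_def cross_def)

lemma dependency_extend:
  fixes v :: "'k \<Rightarrow> real \<times> real"
  assumes "finite M" "N \<subseteq> M" "\<exists>k\<in>N. e k \<noteq> 0" "(\<Sum>k\<in>N. e k *\<^sub>R v k) = 0"
  shows "\<exists>e. (\<exists>k\<in>M. e k \<noteq> 0) \<and> (\<Sum>k\<in>M. e k *\<^sub>R v k) = 0"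
proof -
  have "(\<Sum>k\<in>M. (if k \<in> N then e k else 0) *\<^sub>R v k) = (\<Sum>k\<in>N. e k *\<^sub>R v k)"
    using assms(1,2) by (intro sum.mono_neutral_cong_right) auto
  then show ?thesis using assms(2-4) by (intro exI[of _ "\<lambda>k. if k \<in> N then e k else 0"]) auto
qed

text \<open>
  A single root has a coordinate \<open>\<plusminus> 1\<close>, so a fractional multiple of it is not integral. For two
  independent roots the cross product of the sum with one of them is, up to sign, the coefficient of
  the other, which would be an integer. So there are two parallel roots, which are equal or opposite,
  or at least three roots, and three vectors of the plane satisfy Cramer's identity.
\<close>

lemma roots_dependency:
  fixes v :: "'k \<Rightarrow> real \<times> real"
  assumes fin: "finite M" and ne: "M \<noteq> {}" and v: "\<And>k. k \<in> M \<Longrightarrow> v k \<in> roots"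
    and c: "\<And>k. k \<in> M \<Longrightarrow> 0 < c k \<and> c k < 1"
    and int: "(\<Sum>k\<in>M. c k *\<^sub>R v k) \<in> \<int> \<times> \<int>"
  shows "\<exists>e. (\<exists>k\<in>M. e k \<noteq> 0) \<and> (\<Sum>k\<in>M. e k *\<^sub>R v k) = 0"
proof -
  obtain k where k: "k \<in> M" using ne by auto
  have nk: "c k \<notin> \<int>" "- c k \<notin> \<int>" using c[OF k] frac_not_Ints by auto
  have "M \<noteq> {k}"
    using int nk v[OF k] by (auto simp: roots_def)
  then obtain l where l: "l \<in> M" "l \<noteq> k" using k by auto
  show ?thesis
  proof (cases "cross (v k) (v l) = 0")
    case True
    then consider "v l = v k" | "v l = - v k" using roots_cross(2) v k l by blast
    then show ?thesis
    proof cases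
      case 1
      show ?thesis
        by (rule dependency_extend[of M "{k, l}" "\<lambda>i. if i = k then 1 else - 1"])
          (use fin k l 1 in auto)
    next
      case 2
      show ?thesis
        by (rule dependency_extend[of M "{k, l}" "\<lambda>_. 1"]) (use fin k l 2 in auto)
    qed
  next
    case False
    have "M \<noteq> {k, l}"
    proof
      assume M: "M = {k, l}"
      have "cross (\<Sum>k\<in>M. c k *\<^sub>R v k) (v l) = c k * cross (v k) (v l)"
        using l by (simp add: M cross_def algebra_simps)
      moreover have "cross (\<Sum>k\<in>M. c k *\<^sub>R v k) (v l) \<in> \<int>"
        using int v[OF l(1)] by (auto simp: cross_def roots_def mem_Times_iff)
      ultimately show False using False roots_cross(1)[OF v[OF k] v[OF l(1)]] nk by auto
    qed
    then obtain m where m: "m \<in> M" "m \<noteq> k" "m \<noteq> l" using k l by auto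
    show ?thesis
    proof (rule dependency_extend[of M "{k, l, m}"
          "\<lambda>i. if i = k then cross (v l) (v m) else if i = l then cross (v m) (v k) else cross (v k) (v l)"])
      show "(\<Sum>i\<in>{k, l, m}. (if i = k then cross (v l) (v m) else if i = l then cross (v m) (v k)
              else cross (v k) (v l)) *\<^sub>R v i) = 0"
        using l m by (simp add: cross_def prod_eq_iff algebra_simps)
    qed (use fin k l m False in auto)
  qed
qed

text \<open>
  The point \<open>p *\<^sub>R P + q *\<^sub>R Q\<close> lies in the triangle with vertices \<open>0\<close>, \<open>P\<close>, \<open>Q\<close>. Its moves are
  directions, in the coordinates \<open>(p, q)\<close>, that span the smallest face of the triangle containing it;
  a vertex has none.
\<close>

definition moves :: "real \<Rightarrow> real \<Rightarrow> (real \<times> real) set" where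
  "moves p q = (if p + q < 1 then (if 0 < p then {(1, 0)} else {}) \<union> (if 0 < q then {(0, 1)} else {})
     else if 0 < p \<and> 0 < q then {(1, - 1)} else {})"

text \<open>
  The coefficient with which the move \<open>m\<close> enters the point: relative to a vertex of the
  triangle, the point is the sum of its moves with these coefficients (\<open>moves_expand\<close>). For the move
  \<open>(1, - 1)\<close> along the edge from \<open>Q\<close> to \<open>P\<close>, it is \<open>p\<close> and the vertex is \<open>Q\<close>.
\<close>

definition weight :: "real \<Rightarrow> real \<Rightarrow> real \<times> real \<Rightarrow> real" where
  "weight p q m = (if fst m = 0 then q else p)"

lemma weight_moves:
  assumes "m \<in> moves p q" "0 \<le> p" "0 \<le> q" "p + q \<le> 1"
  shows "0 < weight p q m" "weight p q m < 1"
  using assms by (auto simp: moves_def weight_def split: if_splits)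

lemma finite_moves [simp]: "finite (moves p q)"
  by (simp add: moves_def)

lemma moves_expand:
  fixes P Q :: "real \<times> real"
  assumes "0 \<le> p" "0 \<le> q" "p + q \<le> 1"
  shows "p *\<^sub>R P + q *\<^sub>R Q - (\<Sum>m\<in>moves p q. weight p q m *\<^sub>R (fst m *\<^sub>R P + snd m *\<^sub>R Q)) \<in> {0, P, Q}"
proof -
  have "p = 1" if "\<not> p + q < 1" "q = 0" using that assms by auto
  moreover have "q = 1" if "\<not> p + q < 1" "p = 0" using that assms by auto
  moreover have "p *\<^sub>R Q + q *\<^sub>R Q = Q" if "\<not> p + q < 1"
    using that assms by (simp flip: scaleR_add_left)
  ultimately show ?thesis using assms(1,2)
    by (auto simp: moves_def weight_def algebra_simps)
qed

lemma moves_empty: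
  assumes "moves p q = {}" "0 \<le> p" "0 \<le> q" "p + q \<le> 1"
  shows "p + q \<in> {0, 1}"
  using assms by (auto simp: moves_def split: if_splits)

text \<open>
  A coordinate that has reached its bound is fixed by every move, the others have room on both sides.
  The second part is the linear independence of the moves at one point.
\<close>

lemma moves_feasible:
  assumes "0 \<le> p" "0 \<le> q" "p + q \<le> 1"
  defines "a e \<equiv> (\<Sum>m\<in>moves p q. e m *\<^sub>R fst m)" and "b e \<equiv> (\<Sum>m\<in>moves p q. e m *\<^sub>R snd m)"
  shows "\<forall>\<^sub>F s in nhds 0. 0 \<le> p + s * a e \<and> 0 \<le> q + s * b e \<and> (p + s * a e) + (q + s * b e) \<le> (1::real)"
    and "a e = 0 \<Longrightarrow> b e = 0 \<Longrightarrow> m \<in> moves p q \<Longrightarrow> e m = 0"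
proof -
  have 1: "\<forall>\<^sub>F s in nhds 0. 0 \<le> y + s * r" if "0 \<le> y" "y = 0 \<Longrightarrow> r = 0" for y r :: real
  proof (cases "y = 0")
    case False
    then have "\<forall>\<^sub>F s in nhds 0. 0 < y + s * r"
      using that by (intro eventually_affine_pos) simp
    then show ?thesis by (auto elim: eventually_mono)
  qed (use that in auto)
  have "p = 0 \<Longrightarrow> a e = 0" "q = 0 \<Longrightarrow> b e = 0" "1 - p - q = 0 \<Longrightarrow> - a e - b e = 0"
    by (auto simp: a_def b_def moves_def split: if_splits)
  then have "\<forall>\<^sub>F s in nhds 0. 0 \<le> p + s * a e" "\<forall>\<^sub>F s in nhds 0. 0 \<le> q + s * b e"
    "\<forall>\<^sub>F s in nhds 0. 0 \<le> (1 - p - q) + s * (- a e - b e)"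
    using assms(1-3) by (intro 1; auto)+
  then show "\<forall>\<^sub>F s in nhds 0. 0 \<le> p + s * a e \<and> 0 \<le> q + s * b e \<and> (p + s * a e) + (q + s * b e) \<le> (1::real)"
    by eventually_elim (auto simp: algebra_simps)
  show "a e = 0 \<Longrightarrow> b e = 0 \<Longrightarrow> m \<in> moves p q \<Longrightarrow> e m = 0"
    by (auto simp: a_def b_def moves_def split: if_splits)
qed

section \<open>Extreme points at which the cover inequality is tight\<close>

text \<open>
  The three pairs of neighbouring ray points, in the coordinates \<open>(\<alpha>, \<beta>)\<close>. From left to right the four
  vectors stand for \<open>x = 1\<close> and \<open>f = - F\<close>, \<open>f = d - F\<close>, \<open>f = d\<close>, \<open>f = F\<close>.
\<close>

definition chambers :: "((real \<times> real) \<times> (real \<times> real)) set" where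
  "chambers = {((0, - 1), (1, - 1)), ((1, - 1), (1, 0)), ((1, 0), (0, 1))}"

lemma chambers_roots:
  assumes "(P, Q) \<in> chambers"
  shows "P \<in> roots" "Q \<in> roots" "P - Q \<in> roots"
  using assms by (auto simp: chambers_def roots_def)

text \<open>
  In the first chamber the minimum in \<open>cover\<close> is its first term, in the second its middle term, in the
  third its last term; neighbouring terms agree on the ray between their chambers. At
  \<open>x = 1\<close> the minimum is \<open>(F - d) * d\<close> for \<open>f \<in> {d - F, d}\<close> and \<open>0\<close> for \<open>f \<in> {- F, F}\<close>, which are
  the values prescribed by the coordinate \<open>\<alpha>\<close>.
\<close>

lemma cover_chamber:
  assumes "(P, Q) \<in> chambers" "0 \<le> p" "0 \<le> q" "0 < d" "d < F"
  defines "w \<equiv> p *\<^sub>R P + q *\<^sub>R Q"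
  shows "\<bar>F * snd w + d * fst w\<bar> \<le> F * (p + q)"
    and "cover F d (p + q) (F * snd w + d * fst w) = (F - d) * d * fst w"
proof -
  have nn: "0 \<le> F * p" "0 \<le> F * q" "0 \<le> d * p" "0 \<le> d * q" "0 \<le> (F - d) * p" "0 \<le> (F - d) * q"
    "0 \<le> d * ((F - d) * p)" "0 \<le> d * ((F - d) * q)" "0 \<le> F * (F * p)" "0 \<le> F * (d * p)" "0 \<le> F * (d * q)"
    "0 \<le> F * ((F - d) * q)" "0 \<le> F * ((F - d) * p)"
    using assms by auto
  then show "\<bar>F * snd w + d * fst w\<bar> \<le> F * (p + q)"
    using assms(1) by (auto simp: chambers_def w_def abs_le_iff algebra_simps)
  have "cover F d (p + q) (F * snd w + d * fst w) = min ((F - d) * (F * (p + q) + (F * snd w + d * fst w)))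
      (min ((F - d) * d * (p + q)) (d * (F * (p + q) - (F * snd w + d * fst w))))"
    by (simp add: cover_def)
  then show "cover F d (p + q) (F * snd w + d * fst w) = (F - d) * d * fst w"
    using nn assms(1) by (auto simp: chambers_def w_def algebra_simps min_def)
qed

lemma chamber_exists:
  assumes "0 < d" "d < F" "\<bar>f\<bar> \<le> F * x"
  shows "\<exists>P Q p q. (P, Q) \<in> chambers \<and> 0 \<le> p \<and> 0 \<le> q \<and> x = p + q \<and>
     f = F * snd (p *\<^sub>R P + q *\<^sub>R Q) + d * fst (p *\<^sub>R P + q *\<^sub>R Q)"
proof -
  consider "f \<le> (d - F) * x" | "(d - F) * x \<le> f" "f \<le> d * x" | "d * x \<le> f" by linarith
  then show ?thesis
  proof cases
    case 1
    define q where "q = (F * x + f) / d"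
    have q: "d * q = F * x + f" using assms by (simp add: q_def)
    have "0 \<le> q" "q \<le> x" using assms 1 by (auto simp: q_def field_simps)
    then show ?thesis using q
      by (intro exI[of _ "(0, - 1)"] exI[of _ "(1, - 1)"] exI[of _ "x - q"] exI[of _ q])
        (auto simp: chambers_def algebra_simps)
  next
    case 2
    define p where "p = (d * x - f) / F"
    have p: "F * p = d * x - f" using assms by (simp add: p_def)
    have "0 \<le> p" "p \<le> x" using assms 2 by (auto simp: p_def field_simps)
    then show ?thesis using p
      by (intro exI[of _ "(1, - 1)"] exI[of _ "(1, 0)"] exI[of _ p] exI[of _ "x - p"])
        (auto simp: chambers_def algebra_simps)
  next
    case 3
    define q where "q = (f - d * x) / (F - d)"
    have q: "(F - d) * q = f - d * x" using assms by (simp add: q_def)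
    have "0 \<le> q" "q \<le> x" using assms 3 by (auto simp: q_def field_simps)
    then show ?thesis using q
      by (intro exI[of _ "(1, 0)"] exI[of _ "(0, 1)"] exI[of _ "x - q"] exI[of _ q])
        (auto simp: chambers_def algebra_simps)
  qed
qed

text \<open>
  Neighbouring ray points have different flows, so a motion of the weights \<open>(p, q)\<close> moves \<open>(x, f)\<close>.
\<close>

lemma chamber_inj:
  assumes "(P, Q) \<in> chambers" "0 < d" "d < F" "a + b = 0"
    and "F * snd (a *\<^sub>R P + b *\<^sub>R Q) + d * fst (a *\<^sub>R P + b *\<^sub>R Q) = 0"
  shows "a = 0" "b = 0"
proof -
  have "a = - b" using assms by simp
  then have "b = 0"
    using assms(1-3,5) unfolding \<open>a = - b\<close> by (auto simp: chambers_def algebra_simps)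
  then show "a = 0" "b = 0" using assms(4) by auto
qed

text \<open>
  All moves at all indices are collected in one family \<open>M\<close> of roots. Subtracting a vertex of its
  triangle from each term of the integral total \<open>(1, 0)\<close> leaves the combination of the roots in \<open>M\<close>
  with fractional coefficients, which is therefore integral. A dependency of these roots moves the
  weights while the total stays \<open>(1, 0)\<close>, that is, while \<open>\<Sum>\<^sub>j f\<^sub>j\<close> and the sum of the cover terms stay
  constant.
\<close>

lemma extreme_point_binary_if_tight:
  fixes x f :: "'n::finite \<Rightarrow> real"
  assumes d: "0 < d" "d < F" and ext: "flow_point x f extreme_point_of flow_polytope F d"
    and tight: "(\<Sum>j\<in>UNIV. cover F d (x j) (f j)) = (F - d) * d"
  shows "x j \<in> {0, 1}"
proof (rule ccontr)
  assume frac: "x j \<notin> {0, 1}"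
  have mem: "(\<Sum>j\<in>UNIV. f j) = d" "x i \<le> 1" "\<bar>f i\<bar> \<le> F * x i" for i
    using ext by (auto simp: extreme_point_of_def flow_point_in_flow_polytope)
  obtain P Q p q where PQ: "(P i, Q i) \<in> chambers" and pq: "0 \<le> p i" "0 \<le> q i" "x i = p i + q i"
    and f: "f i = F * snd (p i *\<^sub>R P i + q i *\<^sub>R Q i) + d * fst (p i *\<^sub>R P i + q i *\<^sub>R Q i)" for i
    using chamber_exists[OF d mem(3)] by metis
  have pq1: "p i + q i \<le> 1" for i using mem(2)[of i] pq(3) by simp
  \<comment> \<open>The cover inequality and the flow balance determine the two coordinates of this total.\<close>
  define W where "W = (\<Sum>i\<in>UNIV. p i *\<^sub>R P i + q i *\<^sub>R Q i)"
  have "(F - d) * d * fst W = (F - d) * d * 1"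
    using tight cover_chamber(2)[OF PQ pq(1,2) d] unfolding f pq(3) W_def
    by (simp add: fst_sum sum_distrib_left)
  then have W1: "fst W = 1" using d by simp
  have "F * snd W + d * fst W = d"
    using mem(1) unfolding f W_def fst_sum snd_sum by (simp add: sum.distrib sum_distrib_left distrib_left)
  then have W2: "snd W = 0" using W1 d by simp
  define M where "M = (SIGMA i:UNIV. moves (p i) (q i))"
  define v where "v = (\<lambda>(i, m). fst m *\<^sub>R P i + snd m *\<^sub>R Q i)"
  have sum_M: "(\<Sum>k\<in>M. h k) = (\<Sum>i\<in>UNIV. \<Sum>m\<in>moves (p i) (q i). h (i, m))"
    for h :: "'n \<times> real \<times> real \<Rightarrow> real \<times> real"
    unfolding M_def by (subst sum.Sigma) auto
  have "\<exists>e. (\<exists>k\<in>M. e k \<noteq> 0) \<and> (\<Sum>k\<in>M. e k *\<^sub>R v k) = 0"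
  proof (rule roots_dependency[where c = "\<lambda>(i, m). weight (p i) (q i) m"])
    show "finite M" by (simp add: M_def)
    show "M \<noteq> {}" using moves_empty[OF _ pq(1,2)[of j] pq1[of j]] frac pq(3)[of j] by (auto simp: M_def)
    show "v k \<in> roots" if "k \<in> M" for k
      using that chambers_roots[OF PQ[of "fst k"]] by (auto simp: M_def v_def moves_def split: if_splits)
    show "0 < (case k of (i, m) \<Rightarrow> weight (p i) (q i) m) \<and> (case k of (i, m) \<Rightarrow> weight (p i) (q i) m) < 1"
      if "k \<in> M" for k
      using that weight_moves pq(1,2) pq1 by (auto simp: M_def)
    \<comment> \<open>The vertex that remains of the term at \<open>i\<close> when its moves are removed; it is integral.\<close>
    define r where "r i = p i *\<^sub>R P i + q i *\<^sub>R Q i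
      - (\<Sum>m\<in>moves (p i) (q i). weight (p i) (q i) m *\<^sub>R (fst m *\<^sub>R P i + snd m *\<^sub>R Q i))" for i
    have "(\<Sum>k\<in>M. (case k of (i, m) \<Rightarrow> weight (p i) (q i) m) *\<^sub>R v k) = W - (\<Sum>i\<in>UNIV. r i)"
      unfolding sum_M W_def r_def sum_subtractf by (simp add: v_def)
    moreover have "fst (r i) \<in> \<int> \<and> snd (r i) \<in> \<int>" for i
      using moves_expand[OF pq(1,2) pq1, of i "P i" "Q i"] PQ[of i]
      unfolding r_def[symmetric] by (auto simp: chambers_def)
    ultimately show "(\<Sum>k\<in>M. (case k of (i, m) \<Rightarrow> weight (p i) (q i) m) *\<^sub>R v k) \<in> \<int> \<times> \<int>"
      by (auto simp: mem_Times_iff W1 W2 fst_sum snd_sum intro!: Ints_diff)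
  qed
  then obtain e i0 m0 where ne: "m0 \<in> moves (p i0) (q i0)" "e (i0, m0) \<noteq> 0"
    and dep: "(\<Sum>k\<in>M. e k *\<^sub>R v k) = 0"
    by (auto simp: M_def)
  define a b where "a i = (\<Sum>m\<in>moves (p i) (q i). e (i, m) *\<^sub>R fst m)"
    and "b i = (\<Sum>m\<in>moves (p i) (q i). e (i, m) *\<^sub>R snd m)" for i
  define w where "w i = a i *\<^sub>R P i + b i *\<^sub>R Q i" for i
  have w0: "(\<Sum>i\<in>UNIV. w i) = 0"
    using dep unfolding sum_M
    by (simp add: w_def a_def b_def v_def scaleR_sum_left scaleR_add_right sum.distrib)
  define u g where "u i = a i + b i" and "g i = F * snd (w i) + d * fst (w i)" for i
  have box: "\<forall>\<^sub>F s in nhds 0. 0 \<le> p i + s * a i \<and> 0 \<le> q i + s * b i \<and> (p i + s * a i) + (q i + s * b i) \<le> 1" for i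
    unfolding a_def b_def by (rule moves_feasible(1)[OF pq(1,2) pq1])
  have x': "x i + s * u i = (p i + s * a i) + (q i + s * b i)" for i s
    by (simp add: pq(3) u_def algebra_simps)
  have f': "f i + s * g i = F * snd ((p i + s * a i) *\<^sub>R P i + (q i + s * b i) *\<^sub>R Q i)
      + d * fst ((p i + s * a i) *\<^sub>R P i + (q i + s * b i) *\<^sub>R Q i)" for i s
    by (simp add: f g_def w_def algebra_simps)
  have "u i0 = 0 \<and> g i0 = 0"
  proof (rule extreme_flow_point_rigid[OF ext])
    show g0: "(\<Sum>i\<in>UNIV. g i) = 0"
      using arg_cong[OF w0, of fst] arg_cong[OF w0, of snd]
      by (simp add: g_def sum.distrib fst_sum snd_sum flip: sum_distrib_left)
    show "\<forall>\<^sub>F s in nhds 0. 0 \<le> x i + s * u i \<and> x i + s * u i \<le> 1 \<and> \<bar>f i + s * g i\<bar> \<le> F * (x i + s * u i)" for i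
      using box[of i] by eventually_elim (use cover_chamber(1)[OF PQ _ _ d] in \<open>auto simp: x' f'\<close>)
    have "\<forall>\<^sub>F s in nhds 0. \<forall>i. 0 \<le> p i + s * a i \<and> 0 \<le> q i + s * b i \<and> (p i + s * a i) + (q i + s * b i) \<le> 1"
      using box by (intro eventually_all_finite)
    then show "\<forall>\<^sub>F s in nhds 0. (F - d) * d \<le> (\<Sum>i\<in>UNIV. cover F d (x i + s * u i) (f i + s * g i))"
    proof eventually_elim
      case (elim s)
      have "cover F d (x i + s * u i) (f i + s * g i)
          = (F - d) * d * fst ((p i *\<^sub>R P i + q i *\<^sub>R Q i) + s *\<^sub>R w i)" for i
        unfolding x' f' using elim cover_chamber(2)[OF PQ _ _ d, of "p i + s * a i" "q i + s * b i" i]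
        by (simp add: w_def algebra_simps)
      then have "(\<Sum>i\<in>UNIV. cover F d (x i + s * u i) (f i + s * g i))
          = (F - d) * d * fst (W + s *\<^sub>R (\<Sum>i\<in>UNIV. w i))"
        by (simp only: W_def fst_sum fst_add fst_scaleR sum.distrib sum_distrib_left scaleR_sum_right)
          (simp only: distrib_left sum.distrib sum_distrib_left)
      then show ?case using w0 W1 by simp
    qed
  qed
  then have "a i0 = 0" "b i0 = 0"
    using chamber_inj[OF PQ d, of "a i0" "b i0" i0] by (auto simp: u_def g_def w_def)
  then show False
    using moves_feasible(2)[OF pq(1)[of i0] pq(2)[of i0] pq1[of i0], where e = "\<lambda>m. e (i0, m)" and m = m0] ne
    by (simp add: a_def b_def)
qed

section \<open>The convex hull\<close>

theorem theorem3:
  fixes fbar d :: real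
  assumes "0 \<le> d" and "d < fbar"
  shows "convex hull (flow_set fbar d) =
    (flow_polytope fbar d :: ((real ^ 'n::finite) \<times> (real ^ 'n option)) set)"
proof
  show "convex hull (flow_set fbar d) \<subseteq> (flow_polytope fbar d :: ((real ^ 'n) \<times> (real ^ 'n option)) set)"
    using flow_set_subset_flow_polytope[OF assms] convex_flow_polytope by (rule hull_minimal)
  have "{z. z extreme_point_of flow_polytope fbar d} \<subseteq> (flow_set fbar d :: ((real ^ 'n) \<times> (real ^ 'n option)) set)"
  proof
    fix z :: "(real ^ 'n) \<times> (real ^ 'n option)"
    assume "z \<in> {z. z extreme_point_of flow_polytope fbar d}"
    then have ext: "z extreme_point_of flow_polytope fbar d" by simp
    then have z: "z \<in> flow_polytope fbar d" by (simp add: extreme_point_of_def)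
    then obtain x f where zxf: "z = flow_point x f" by (rule flow_polytope_cases)
    have "x j \<in> {0, 1}" for j
      using extreme_point_binary_if_loose[of d fbar x f j] extreme_point_binary_if_tight[of d fbar x f j]
        ext z assms unfolding zxf flow_point_in_flow_polytope by fastforce
    moreover have "f j \<le> fbar * x j" "- (fbar * x j) \<le> f j" "(\<Sum>j\<in>UNIV. f j) = d" for j
      using z by (auto simp: zxf flow_point_in_flow_polytope abs_le_iff minus_le_iff)
    ultimately show "z \<in> flow_set fbar d"
      by (simp add: zxf flow_set_def flow_point_def UNIV_option_conv sum.reindex)
  qed
  then have "convex hull {z. z extreme_point_of flow_polytope fbar d}
      \<subseteq> convex hull (flow_set fbar d :: ((real ^ 'n) \<times> (real ^ 'n option)) set)"
    by (rule hull_mono)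
  moreover have "compact (flow_polytope fbar d :: ((real ^ 'n) \<times> (real ^ 'n option)) set)"
    using assms by (intro compact_flow_polytope) simp
  ultimately show "(flow_polytope fbar d :: ((real ^ 'n) \<times> (real ^ 'n option)) set) \<subseteq> convex hull (flow_set fbar d)"
    using Krein_Milman_Minkowski[OF _ convex_flow_polytope] by blast
qed

end
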